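(* There exists a $K_{3,3}$-free latin square of order $16$; moreover, such a latin square can be obtained as a switched combination of two orthogonal latin squares of order $8$.
   Context: A latin square of order $n$ is a set $S$ of $n^2$ ordered triples from $R\times C\times L$, where $|R|=|C|=|L|=n$, such that no two triples from $S$ differ in exactly one position; one writes $S(r,c)=l$ if $(r,c,l)\in S$. The graph $\Gamma(S)$ has vertex set $S$, two distinct vertices $(r,c,l)$, $(r',c',l')$ being adjacent if and only if $r=r'$, $c=c'$, or $l=l'$. The latin square $S$ is $K_{3,3}$-free if $\Gamma(S)$ has no induced subgraph isomorphic to the complete bipartite graph $K_{3,3}$. Two latin squares $A$ and $B$ with the same sets of rows and columns are orthogonal if $(r,c,l),(r',c',l)\in A$ and $(r,c,g),(r',c',g)\in B$ imply $(r,c)=(r',c')$. Switched combination: let $A_0$ and $A_1$ be two $n\times n$ latin squares with rows and columns indexed by $\{0,1,\ldots,n-1\}$, where the letters of $A_0$ are $\{0,2,\ldots,2n-2\}$ and the letters of $A_1$ are $\{1,3,\ldots,2n-1\}$. Let $S$ be an $n\times n$ array with values in $\{0,1\}$ (the switching matrix). The switched combination of $A_0$ and $A_1$ with switching matrix $S$ is the $2n\times 2n$ latin square $L$ with rows and columns indexed by $\{0,\ldots,2n-1\}$ defined by $$L(r,c)=A_{r\oplus c\oplus S(\lfloor r/2\rfloor,\lfloor c/2\rfloor)}(\lfloor r/2\rfloor,\lfloor c/2\rfloor),$$ where $\oplus$ is addition modulo $2$ (so the index of $A$ is the parity of $r+c+S(\lfloor r/2\rfloor,\lfloor c/2\rfloor)$).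 *)

theory Defs
  imports "Graph_Theory.Graph_Theory"
begin

definition differ_in_one :: "'r \<times> 'c \<times> 'l \<Rightarrow> 'r \<times> 'c \<times> 'l \<Rightarrow> bool" where
  "differ_in_one = (\<lambda>(r, c, l) (r', c', l').
     (r \<noteq> r' \<and> c = c' \<and> l = l') \<or>
     (r = r' \<and> c \<noteq> c' \<and> l = l') \<or>
     (r = r' \<and> c = c' \<and> l \<noteq> l'))"

definition latin_square ::
    "'r set \<Rightarrow> 'c set \<Rightarrow> 'l set \<Rightarrow> nat \<Rightarrow> ('r \<times> 'c \<times> 'l) set \<Rightarrow> bool" where
  "latin_square R C L n S \<longleftrightarrow>
     finite R \<and> finite C \<and> finite L \<and> card R = n \<and> card C = n \<and> card L = n \<and>
     S \<subseteq> R \<times> C \<times> L \<and> card S = n ^ 2 \<and>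
     (\<forall>s\<in>S. \<forall>t\<in>S. \<not> differ_in_one s t)"

text \<open>Undirected graphs are represented as symmetric loop-free digraphs.\<close>

definition latin_graph :: "('r \<times> 'c \<times> 'l) set \<Rightarrow> ('r \<times> 'c \<times> 'l) pair_pre_digraph" where
  "latin_graph S = \<lparr> pverts = S,
     parcs = {((r, c, l), (r', c', l')) | r c l r' c' l'.
       (r, c, l) \<in> S \<and> (r', c', l') \<in> S \<and> (r, c, l) \<noteq> (r', c', l') \<and>
       (r = r' \<or> c = c' \<or> l = l')} \<rparr>"

lemma pair_graph_latin_graph:
  assumes "finite S"
  shows "pair_graph (latin_graph S)"
proof -
  have "parcs (latin_graph S) \<subseteq> S \<times> S"
    by (auto simp: latin_graph_def)
  then have "finite (parcs (latin_graph S))"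
    using assms by (meson finite_SigmaI finite_subset)
  moreover have "sym (parcs (latin_graph S))"
    by (auto simp: latin_graph_def sym_def)
  ultimately show ?thesis
    using assms
    by unfold_locales (auto simp: latin_graph_def symmetric_def)
qed

definition K33_free :: "('r \<times> 'c \<times> 'l) set \<Rightarrow> bool" where
  "K33_free S \<longleftrightarrow>
     \<not> (\<exists>H. induced_subgraph H (with_proj (latin_graph S)) \<and> complete_bipartite_digraph 3 3 H)"

text \<open>Meant for latin squares with the same sets of rows and columns.\<close>

definition orthogonal_squares :: "('r \<times> 'c \<times> 'l) set \<Rightarrow> ('r \<times> 'c \<times> 'm) set \<Rightarrow> bool" where
  "orthogonal_squares A B \<longleftrightarrow>
     (\<forall>r c r' c' l g. (r, c, l) \<in> A \<and> (r', c', l) \<in> A \<and> (r, c, g) \<in> B \<and> (r', c', g) \<in> B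
        \<longrightarrow> (r, c) = (r', c'))"

definition switching_matrix :: "nat \<Rightarrow> (nat \<Rightarrow> nat \<Rightarrow> nat) \<Rightarrow> bool" where
  "switching_matrix n S \<longleftrightarrow> (\<forall>i<n. \<forall>j<n. S i j \<in> {0, 1})"

text \<open>The equation \<open>A(i, j) = l\<close> is rendered as \<open>(i, j, l) \<in> A\<close>.\<close>

definition switched_combination ::
    "nat \<Rightarrow> (nat \<times> nat \<times> nat) set \<Rightarrow> (nat \<times> nat \<times> nat) set \<Rightarrow> (nat \<Rightarrow> nat \<Rightarrow> nat)
      \<Rightarrow> (nat \<times> nat \<times> nat) set" where
  "switched_combination n A0 A1 S =
     {(r, c, l). r < 2 * n \<and> c < 2 * n \<and>
        (r div 2, c div 2, l) \<in>
          (if (r + c + S (r div 2) (c div 2)) mod 2 = 0 then A0 else A1)}"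

end

theory Submission
  imports Defs
begin

text \<open>
  In a latin square, an induced \<open>K\<^sub>3\<^sub>,\<^sub>3\<close> is a hexagon: each of its nine edges joins its
  ends by a row, a column or a letter, the types form a latin square of order 3, and so the six
  vertices are cells of a \<open>3 \<times> 3\<close> subarray whose rows read \<open>l\<^sub>0 l\<^sub>2 *\<close>, \<open>* l\<^sub>1 l\<^sub>0\<close>, \<open>l\<^sub>1 * l\<^sub>2\<close>.
  In a switched combination of two orthogonal squares such a hexagon lies over a hexagon of
  \<open>2 \<times> 2\<close> blocks in three distinct block rows, where opposite blocks agree in one of the two
  squares. Conversely a hexagon of blocks lifts exactly if the switching matrix has an even sum
  over its six blocks, because every block row and block column meets two of them. Being
  free of \<open>K\<^sub>3\<^sub>,\<^sub>3\<close> is thus a system of linear equations over GF(2) for the switching matrix,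
  and the pair of squares below is one for which it is solvable.
\<close>

section \<open>Induced K(3,3) in a latin square\<close>

text \<open>The first three triples are one side of the bipartite graph, the last three the other. A
  cyclic shift of all indices preserves the condition.\<close>

definition hexagon ::
    "('r \<times> 'c \<times> 'l) set \<Rightarrow> 'r \<Rightarrow> 'r \<Rightarrow> 'r \<Rightarrow> 'c \<Rightarrow> 'c \<Rightarrow> 'c \<Rightarrow> 'l \<Rightarrow> 'l \<Rightarrow> 'l \<Rightarrow> bool" where
  "hexagon S r0 r1 r2 c0 c1 c2 l0 l1 l2 \<longleftrightarrow>
     distinct [r0, r1, r2] \<and> distinct [c0, c1, c2] \<and> distinct [l0, l1, l2] \<and>
     {(r0, c0, l0), (r1, c1, l1), (r2, c2, l2),
      (r0, c1, l2), (r1, c2, l0), (r2, c0, l1)} \<subseteq> S"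

definition share :: "'r \<times> 'c \<times> 'l \<Rightarrow> 'r \<times> 'c \<times> 'l \<Rightarrow> bool" where
  "share = (\<lambda>(r, c, l) (r', c', l'). r = r' \<or> c = c' \<or> l = l')"

lemma K33_shares:
  assumes "\<not> K33_free S"
  obtains U V where "U \<subseteq> S" "V \<subseteq> S" "card U = 3" "card V = 3"
    "\<And>u v. u \<in> U \<Longrightarrow> v \<in> V \<Longrightarrow> u \<noteq> v \<and> share u v"
    "\<And>u u'. u \<in> U \<Longrightarrow> u' \<in> U \<Longrightarrow> u \<noteq> u' \<Longrightarrow> \<not> share u u'"
    "\<And>v v'. v \<in> V \<Longrightarrow> v' \<in> V \<Longrightarrow> v \<noteq> v' \<Longrightarrow> \<not> share v v'"
proof -
  let ?G = "with_proj (latin_graph S)"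
  obtain H where ind: "induced_subgraph H ?G" and bip: "complete_bipartite_digraph 3 3 H"
    using assms unfolding K33_free_def by blast
  from bip obtain U V where UV: "verts H = U \<union> V" "U \<inter> V = {}" "card U = 3" "card V = 3"
    and ends: "arcs_ends H = U \<times> V \<union> V \<times> U"
    unfolding complete_bipartite_digraph_def by blast
  have sub: "U \<union> V \<subseteq> S"
    using ind UV(1) by (auto simp: induced_subgraph_def subgraph_def latin_graph_def)
  have tail_head: "tail H = fst" "head H = snd"
    using ind by (auto simp: induced_subgraph_def subgraph_def compatible_def)
  have adj: "(x, y) \<in> arcs_ends H \<longleftrightarrow> x \<noteq> y \<and> share x y"
    if "x \<in> U \<union> V" "y \<in> U \<union> V" for x y
    using ind that sub UV(1) tail_head
    by (auto simp: induced_subgraph_def arcs_ends_def arc_to_ends_def latin_graph_def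
        share_def split: prod.splits)
  show thesis
    using UV(2-4) sub adj unfolding ends by (intro that[of U V]) blast+
qed

text \<open>Two cells of \<open>V\<close> meeting \<open>u\<close> in the same coordinate would meet
  each other, so the three cells of \<open>V\<close> use up the three coordinates of
  \<open>u\<close>, one each.\<close>

lemma share_coordinates:
  assumes "card V = 3"
    and share: "\<And>v. v \<in> V \<Longrightarrow> share u v"
    and indep: "\<And>v v'. v \<in> V \<Longrightarrow> v' \<in> V \<Longrightarrow> v \<noteq> v' \<Longrightarrow> \<not> share v v'"
  shows "\<exists>v\<in>V. fst v = fst u" "\<exists>v\<in>V. fst (snd v) = fst (snd u)"
    "\<exists>v\<in>V. snd (snd v) = snd (snd u)"
proof -
  obtain x y z where V: "V = {x, y, z}" and xyz: "x \<noteq> y" "y \<noteq> z" "x \<noteq> z"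
    using assms(1) by (auto simp: card_3_iff)
  have "share u x" "share u y" "share u z" using share V by auto
  moreover have "\<not> share x y" "\<not> share y z" "\<not> share x z" using indep V xyz by auto
  ultimately show "\<exists>v\<in>V. fst v = fst u" "\<exists>v\<in>V. fst (snd v) = fst (snd u)"
    "\<exists>v\<in>V. snd (snd v) = snd (snd u)"
    unfolding V by (cases u; cases x; cases y; cases z; force simp: share_def)+
qed

lemma share_sym: "share u v \<longleftrightarrow> share v u"
  by (auto simp: share_def split: prod.splits)

lemma K33_free_if_no_hexagon:
  assumes lat: "\<forall>s\<in>S. \<forall>t\<in>S. \<not> differ_in_one s t"
    and no_hexagon: "\<And>r0 r1 r2 c0 c1 c2 l0 l1 l2. \<not> hexagon S r0 r1 r2 c0 c1 c2 l0 l1 l2"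
  shows "K33_free S"
proof (rule ccontr)
  assume "\<not> K33_free S"
  then obtain U V where sub: "U \<subseteq> S" "V \<subseteq> S" and card: "card U = 3" "card V = 3"
    and UV: "\<And>u v. u \<in> U \<Longrightarrow> v \<in> V \<Longrightarrow> u \<noteq> v \<and> share u v"
    and UU: "\<And>u u'. u \<in> U \<Longrightarrow> u' \<in> U \<Longrightarrow> u \<noteq> u' \<Longrightarrow> \<not> share u u'"
    and VV: "\<And>v v'. v \<in> V \<Longrightarrow> v' \<in> V \<Longrightarrow> v \<noteq> v' \<Longrightarrow> \<not> share v v'"
    by (rule K33_shares) metis
  note U = share_coordinates[OF card(1)] and V = share_coordinates[OF card(2)]
  obtain r0 c0 l0 where x0: "(r0, c0, l0) \<in> U"
    using card by (metis card.empty ex_in_conv prod_cases3 zero_neq_numeral)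
  \<comment> \<open>\<open>y0\<close> is the neighbour of \<open>x0\<close> along its row,
    \<open>x1\<close> and \<open>x2\<close> are those of \<open>y0\<close> along its column and
    letter, \<open>y2\<close> and \<open>y1\<close> those of \<open>x0\<close> along its column and
    letter. Only the primed coordinates remain to be identified.\<close>
  obtain c1 l2 where y0: "(r0, c1, l2) \<in> V"
    using V(1)[of "(r0, c0, l0)"] UV VV x0 by fastforce
  obtain r1 l1 where x1: "(r1, c1, l1) \<in> U"
    using U(2)[of "(r0, c1, l2)"] UV UU y0 share_sym by fastforce
  obtain r2 c2 where x2: "(r2, c2, l2) \<in> U"
    using U(3)[of "(r0, c1, l2)"] UV UU y0 share_sym by fastforce
  obtain r2' l1' where y2: "(r2', c0, l1') \<in> V"
    using V(2)[of "(r0, c0, l0)"] UV VV x0 by fastforce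
  obtain r1' c2' where y1: "(r1', c2', l0) \<in> V"
    using V(3)[of "(r0, c0, l0)"] UV VV x0 by fastforce
  have nd: "\<not> differ_in_one u v" if "u \<in> U" "v \<in> V" for u v
    using lat sub that by blast
  note [simp] = share_def differ_in_one_def
  \<comment> \<open>Adjacent cells of a latin square have exactly one coordinate in common.\<close>
  have ne: "c0 \<noteq> c1" "l0 \<noteq> l2" "r1 \<noteq> r0" "l1 \<noteq> l2" "r2 \<noteq> r0" "c2 \<noteq> c1"
    using nd[OF x0 y0] nd[OF x1 y0] nd[OF x2 y0] UV[OF x0 y0] UV[OF x1 y0] UV[OF x2 y0]
    by auto
  have d: "r1 \<noteq> r2" "c0 \<noteq> c2" "l0 \<noteq> l1"
    using UU[OF x1 x2] UU[OF x0 x2] UU[OF x0 x1] ne by auto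
  have d': "r2' \<noteq> r0" "l1' \<noteq> l2" "r1' \<noteq> r0" "c2' \<noteq> c1"
    using VV[OF y0 y2] VV[OF y0 y1] ne by auto
  \<comment> \<open>\<open>x2\<close> and \<open>y2\<close> can only share the row, which leaves the
    letter for \<open>x1\<close> and \<open>y2\<close>. Likewise \<open>y1\<close> shares the row
    with \<open>x1\<close> and then the column with \<open>x2\<close>.\<close>
  have "r2' = r2" "l1' = l1"
    using UV[OF x1 y2] UV[OF x2 y2] nd[OF x1 y2] nd[OF x2 y2] ne d d' by auto
  moreover have "r1' = r1" "c2' = c2"
    using UV[OF x1 y1] UV[OF x2 y1] nd[OF x1 y1] nd[OF x2 y1] ne d d' by auto
  ultimately have "hexagon S r0 r1 r2 c0 c1 c2 l0 l1 l2"
    using x0 x1 x2 y0 y1 y2 sub ne d by (auto simp: hexagon_def)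
  then show False using no_hexagon by blast
qed

section \<open>Switched combinations\<close>

definition array_triples :: "nat \<Rightarrow> (nat \<Rightarrow> nat \<Rightarrow> nat) \<Rightarrow> (nat \<times> nat \<times> nat) set" where
  "array_triples n f = (\<lambda>(i, j). (i, j, f i j)) ` ({..<n} \<times> {..<n})"

definition latin_array :: "nat \<Rightarrow> (nat \<Rightarrow> nat \<Rightarrow> nat) \<Rightarrow> bool" where
  "latin_array n f \<longleftrightarrow>
     (\<forall>i<n. inj_on (f i) {..<n}) \<and> (\<forall>j<n. inj_on (\<lambda>i. f i j) {..<n}) \<and>
     (\<forall>i<n. \<forall>j<n. f i j < n)"

lemma latin_arrayD:
  assumes "latin_array n f"
  shows "\<lbrakk>f i j = f i j'; i < n; j < n; j' < n\<rbrakk> \<Longrightarrow> j = j'"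
    and "\<lbrakk>f i j = f i' j; j < n; i < n; i' < n\<rbrakk> \<Longrightarrow> i = i'"
    and "\<lbrakk>i < n; j < n\<rbrakk> \<Longrightarrow> f i j < n"
  using assms unfolding latin_array_def inj_on_def lessThan_iff by blast+

lemma latin_arrayI:
  assumes "\<And>i j j'. \<lbrakk>i < n; j < n; j' < n; f i j = f i j'\<rbrakk> \<Longrightarrow> j = j'"
    and "\<And>i i' j. \<lbrakk>j < n; i < n; i' < n; f i j = f i' j\<rbrakk> \<Longrightarrow> i = i'"
    and "\<And>i j. \<lbrakk>i < n; j < n\<rbrakk> \<Longrightarrow> f i j < n"
  shows "latin_array n f"
  unfolding latin_array_def inj_on_def Ball_def lessThan_iff
  by (intro conjI allI impI; rule assms; assumption)

lemma mem_array_triples: "(i, j, l) \<in> array_triples n f \<longleftrightarrow> i < n \<and> j < n \<and> l = f i j"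
  by (auto simp: array_triples_def)

text \<open>The renaming \<open>g\<close> produces the even letters, the odd letters, or with
  \<open>id\<close> the letters of the combination itself.\<close>

lemma latin_square_array_triples:
  assumes f: "latin_array n f" and g: "inj_on g {..<n}"
  shows "latin_square {..<n} {..<n} (g ` {..<n}) n (array_triples n (\<lambda>i j. g (f i j)))"
proof -
  let ?S = "array_triples n (\<lambda>i j. g (f i j))"
  have "card ?S = n ^ 2"
    unfolding array_triples_def
    by (subst card_image) (auto simp: inj_on_def power2_eq_square)
  moreover have "\<not> differ_in_one s t" if s: "s \<in> ?S" and t: "t \<in> ?S" for s t
  proof -
    obtain i j i' j' where eq: "s = (i, j, g (f i j))" "t = (i', j', g (f i' j'))"
      and lt: "i < n" "j < n" "i' < n" "j' < n"
      using s t by (auto simp: array_triples_def)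
    have "f i j = f i' j'" if "g (f i j) = g (f i' j')"
      using inj_onD[OF g that] latin_arrayD(3)[OF f] lt by simp
    then show ?thesis
      using latin_arrayD(1,2)[OF f] lt unfolding eq differ_in_one_def prod.case by metis
  qed
  moreover have "?S \<subseteq> {..<n} \<times> {..<n} \<times> g ` {..<n}"
    using f by (auto simp: array_triples_def latin_array_def)
  ultimately show ?thesis
    using g by (auto simp: latin_square_def card_image)
qed

lemma orthogonal_squares_array_triples:
  assumes "inj_on (\<lambda>(i, j). (f i j, g i j)) ({..<n} \<times> {..<n})"
  shows "orthogonal_squares (array_triples n f) (array_triples n g)"
  using assms unfolding orthogonal_squares_def mem_array_triples inj_on_def by force

section \<open>Letters and blocks of a switched combination\<close>

definition switched_array ::
    "(nat \<Rightarrow> nat \<Rightarrow> nat) \<Rightarrow> (nat \<Rightarrow> nat \<Rightarrow> nat) \<Rightarrow> (nat \<Rightarrow> nat \<Rightarrow> nat) \<Rightarrow> nat \<Rightarrow> nat \<Rightarrow> nat" where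
  "switched_array a b S r c =
     (if even (r + c + S (r div 2) (c div 2)) then 2 * a (r div 2) (c div 2)
      else 2 * b (r div 2) (c div 2) + 1)"

lemma switched_combination_array_triples:
  "switched_combination n (array_triples n (\<lambda>i j. 2 * a i j))
     (array_triples n (\<lambda>i j. 2 * b i j + 1)) S =
   array_triples (2 * n) (switched_array a b S)"
  by (auto simp: switched_combination_def mem_array_triples switched_array_def
      even_iff_mod_2_eq_zero split: if_splits)

text \<open>The parity of a letter tells which square it comes from, so equal letters arise from the
  same choice of square, in which their blocks then agree.\<close>

lemma switched_array_eqD:
  assumes "switched_array a b S r c = switched_array a b S r' c'"
  shows "even (r + c + S (r div 2) (c div 2)) \<longleftrightarrow> even (r' + c' + S (r' div 2) (c' div 2))"
    and "a (r div 2) (c div 2) = a (r' div 2) (c' div 2) \<or>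
         b (r div 2) (c div 2) = b (r' div 2) (c' div 2)"
proof -
  have *: "2 * x \<noteq> Suc (2 * y)" for x y :: nat by presburger
  show "even (r + c + S (r div 2) (c div 2)) \<longleftrightarrow> even (r' + c' + S (r' div 2) (c' div 2))"
    using assms * unfolding switched_array_def by (metis Suc_eq_plus1)
  then show "a (r div 2) (c div 2) = a (r' div 2) (c' div 2) \<or>
         b (r div 2) (c div 2) = b (r' div 2) (c' div 2)"
    using assms unfolding switched_array_def by (auto split: if_splits)
qed

text \<open>Hexagons require this for different rows of one block row. Whichever square the two
  blocks agree in, its latin property identifies them.\<close>

lemma switched_array_row_eqD:
  assumes a: "latin_array n a" and b: "latin_array n b"
    and "switched_array a b S r c = switched_array a b S r' c'"
    and "r div 2 = r' div 2" "r < 2 * n" "c < 2 * n" "c' < 2 * n"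
  shows "c div 2 = c' div 2"
proof -
  have "r div 2 < n" "c div 2 < n" "c' div 2 < n" using assms by auto
  then show ?thesis
    using switched_array_eqD(2)[OF assms(3)] assms(4) latin_arrayD(1)[OF a] latin_arrayD(1)[OF b]
    by metis
qed

lemma switched_array_column_eqD:
  assumes a: "latin_array n a" and b: "latin_array n b"
    and "switched_array a b S r c = switched_array a b S r' c'"
    and "c div 2 = c' div 2" "c < 2 * n" "r < 2 * n" "r' < 2 * n"
  shows "r div 2 = r' div 2"
proof -
  have "r div 2 < n" "c div 2 < n" "r' div 2 < n" using assms by auto
  then show ?thesis
    using switched_array_eqD(2)[OF assms(3)] assms(4) latin_arrayD(2)[OF a] latin_arrayD(2)[OF b]
    by metis
qed

lemma latin_array_switched_array:
  assumes a: "latin_array n a" and b: "latin_array n b"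
  shows "latin_array (2 * n) (switched_array a b S)"
proof (rule latin_arrayI)
  fix r c c' assume lt: "r < 2 * n" "c < 2 * n" "c' < 2 * n"
    and eq: "switched_array a b S r c = switched_array a b S r c'"
  have "c div 2 = c' div 2"
    using switched_array_row_eqD[OF a b eq] lt by simp
  \<comment> \<open>The switch is constant on a block, so in a fixed row the parity of the column
    decides between the two letters.\<close>
  moreover from this have "even c \<longleftrightarrow> even c'"
    using switched_array_eqD(1)[OF eq] by auto
  ultimately show "c = c'" by presburger
next
  fix r r' c assume lt: "c < 2 * n" "r < 2 * n" "r' < 2 * n"
    and eq: "switched_array a b S r c = switched_array a b S r' c"
  have "r div 2 = r' div 2"
    using switched_array_column_eqD[OF a b eq] lt by simp
  moreover from this have "even r \<longleftrightarrow> even r'"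
    using switched_array_eqD(1)[OF eq] by auto
  ultimately show "r = r'" by presburger
next
  fix r c assume "r < 2 * n" "c < 2 * n"
  then have "a (r div 2) (c div 2) < n" "b (r div 2) (c div 2) < n"
    using latin_arrayD(3)[OF a] latin_arrayD(3)[OF b] by simp_all
  then show "switched_array a b S r c < 2 * n" unfolding switched_array_def by presburger
qed

text \<open>
  Two rows of a hexagon in the same block row make two opposite cells share a block. Then the
  other two pairs of opposite cells lie in one pair of blocks; as their letters differ, these
  blocks agree in both squares.
\<close>
lemma switched_hexagon_distinct_block_rows:
  assumes a: "latin_array n a" and b: "latin_array n b"
    and orth: "inj_on (\<lambda>(i, j). (a i j, b i j)) ({..<n} \<times> {..<n})"
    and hex: "hexagon (array_triples (2 * n) (switched_array a b S)) r0 r1 r2 c0 c1 c2 l0 l1 l2"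
  shows "r0 div 2 \<noteq> r1 div 2"
proof
  let ?L = "switched_array a b S"
  assume R: "r0 div 2 = r1 div 2"
  have lt: "r0 < 2 * n" "r1 < 2 * n" "r2 < 2 * n" "c0 < 2 * n" "c1 < 2 * n" "c2 < 2 * n"
    and L: "?L r0 c0 = ?L r1 c2" "?L r1 c1 = ?L r2 c0" "?L r2 c2 = ?L r0 c1" "?L r1 c1 \<noteq> ?L r2 c2"
    and d: "distinct [r0, r1, r2]"
    using hex by (auto simp: hexagon_def mem_array_triples)
  have C: "c0 div 2 = c2 div 2"
    using switched_array_row_eqD[OF a b L(1) R] lt by simp
  have "a (r1 div 2) (c1 div 2) = a (r2 div 2) (c0 div 2) \<and>
        b (r1 div 2) (c1 div 2) = b (r2 div 2) (c0 div 2)"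
    using switched_array_eqD[OF L(2)] switched_array_eqD[OF L(3)] L(2-4) R C
    unfolding switched_array_def by (auto split: if_splits)
  moreover have "r1 div 2 < n" "c1 div 2 < n" "r2 div 2 < n" "c0 div 2 < n"
    using lt by simp_all
  \<comment> \<open>Orthogonality identifies the two blocks, which puts three distinct rows into a
    block row of two.\<close>
  ultimately have "r1 div 2 = r2 div 2"
    using inj_onD[OF orth, of "(r1 div 2, c1 div 2)" "(r2 div 2, c0 div 2)"] by simp
  with R d show False by auto
qed

section \<open>Block hexagons and the parity of the switching matrix\<close>

definition agree ::
    "(nat \<Rightarrow> nat \<Rightarrow> nat) \<Rightarrow> (nat \<Rightarrow> nat \<Rightarrow> nat) \<Rightarrow> nat \<Rightarrow> nat \<Rightarrow> nat \<Rightarrow> nat \<Rightarrow> bool" where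
  "agree a b r c r' c' \<longleftrightarrow> a r c = a r' c' \<or> b r c = b r' c'"

text \<open>All indices refer to blocks. Two blocks agree if they have a common letter, and the
  three opposite pairs may agree in different squares. For latin squares the block columns are then
  distinct as well.\<close>

definition even_block_hexagon_free ::
    "nat \<Rightarrow> (nat \<Rightarrow> nat \<Rightarrow> nat) \<Rightarrow> (nat \<Rightarrow> nat \<Rightarrow> nat) \<Rightarrow> (nat \<Rightarrow> nat \<Rightarrow> nat) \<Rightarrow> bool" where
  "even_block_hexagon_free n a b S \<longleftrightarrow>
     (\<forall>r1<n. \<forall>r0<n. \<forall>c0<n. \<forall>c2<n. \<forall>r2<n. \<forall>c1<n.
        r0 \<noteq> r1 \<and> r2 \<noteq> r0 \<and> r2 \<noteq> r1 \<and>
        agree a b r0 c0 r1 c2 \<and> agree a b r2 c0 r1 c1 \<and> agree a b r2 c2 r0 c1 \<longrightarrow>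
        odd (S r0 c0 + S r1 c2 + S r1 c1 + S r2 c0 + S r2 c2 + S r0 c1))"

text \<open>Opposite cells of a hexagon have equal parities of row plus column plus switch. Summing
  over the three pairs, each row and each column occurs twice and cancels, so the six switches have
  an even sum, contrary to \<open>free\<close>.\<close>

lemma K33_free_switched_array:
  assumes a: "latin_array n a" and b: "latin_array n b"
    and orth: "inj_on (\<lambda>(i, j). (a i j, b i j)) ({..<n} \<times> {..<n})"
    and free: "even_block_hexagon_free n a b S"
  shows "K33_free (array_triples (2 * n) (switched_array a b S))"
    (is "K33_free ?Q")
proof (rule K33_free_if_no_hexagon)
  show "\<forall>s\<in>?Q. \<forall>t\<in>?Q. \<not> differ_in_one s t"
    using latin_square_array_triples[OF latin_array_switched_array[OF a b], of id]
    by (auto simp: latin_square_def)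
next
  fix r0 r1 r2 c0 c1 c2 l0 l1 l2
  let ?L = "switched_array a b S"
  show "\<not> hexagon ?Q r0 r1 r2 c0 c1 c2 l0 l1 l2"
  proof
    assume hex: "hexagon ?Q r0 r1 r2 c0 c1 c2 l0 l1 l2"
    \<comment> \<open>Rotating the hexagon makes all three pairs of block rows distinct.\<close>
    then have hex': "hexagon ?Q r1 r2 r0 c1 c2 c0 l1 l2 l0" "hexagon ?Q r2 r0 r1 c2 c0 c1 l2 l0 l1"
      by (auto simp: hexagon_def)
    note d = this[THEN switched_hexagon_distinct_block_rows[OF a b orth]]
      switched_hexagon_distinct_block_rows[OF a b orth hex]
    have lt: "r0 < 2 * n" "r1 < 2 * n" "r2 < 2 * n" "c0 < 2 * n" "c1 < 2 * n" "c2 < 2 * n"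
      and L: "?L r0 c0 = ?L r1 c2" "?L r1 c1 = ?L r2 c0" "?L r2 c2 = ?L r0 c1"
      using hex by (auto simp: hexagon_def mem_array_triples)
    have "odd (S (r0 div 2) (c0 div 2) + S (r1 div 2) (c2 div 2) + S (r1 div 2) (c1 div 2) +
      S (r2 div 2) (c0 div 2) + S (r2 div 2) (c2 div 2) + S (r0 div 2) (c1 div 2))"
      using free[unfolded even_block_hexagon_free_def, rule_format,
          of "r1 div 2" "r0 div 2" "c0 div 2" "c2 div 2" "r2 div 2" "c1 div 2"]
        d lt switched_array_eqD(2)[OF L(1)] switched_array_eqD(2)[OF L(2)[symmetric]]
        switched_array_eqD(2)[OF L(3)]
      by (simp add: agree_def less_mult_imp_div_less mult.commute)
    then show False
      using switched_array_eqD(1)[OF L(1)] switched_array_eqD(1)[OF L(2)]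
        switched_array_eqD(1)[OF L(3)]
      by (simp only: even_add) argo
  qed
qed

section \<open>The squares of order 8\<close>

definition rows0 :: "nat list list" where
  "rows0 =
    [[4, 3, 2, 1, 0, 5, 6, 7],
     [1, 4, 3, 2, 5, 6, 7, 0],
     [6, 1, 0, 3, 2, 7, 4, 5],
     [3, 6, 1, 0, 7, 4, 5, 2],
     [0, 5, 6, 7, 4, 3, 2, 1],
     [5, 2, 7, 4, 1, 0, 3, 6],
     [2, 7, 4, 5, 6, 1, 0, 3],
     [7, 0, 5, 6, 3, 2, 1, 4]]"

definition square0 :: "nat \<Rightarrow> nat \<Rightarrow> nat" where
  "square0 i j = rows0 ! i ! j"

definition rows1 :: "nat list list" where
  "rows1 =
    [[0, 1, 2, 3, 4, 5, 6, 7],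
     [5, 6, 0, 4, 3, 7, 2, 1],
     [1, 4, 7, 2, 5, 0, 3, 6],
     [7, 3, 6, 5, 1, 2, 4, 0],
     [3, 0, 5, 6, 7, 4, 1, 2],
     [2, 7, 3, 1, 0, 6, 5, 4],
     [6, 5, 4, 7, 2, 1, 0, 3],
     [4, 2, 1, 0, 6, 3, 7, 5]]"

definition square1 :: "nat \<Rightarrow> nat \<Rightarrow> nat" where
  "square1 i j = rows1 ! i ! j"

text \<open>If the indices in {0,3}, {1,2}, {4,5}, {6,7} are labelled by the vectors 00, 01, 10, 11
  over GF(2), the entry is the dot product of the labels of its row and column.\<close>

definition rows_S :: "nat list list" where
  "rows_S =
    [[0, 0, 0, 0, 0, 0, 0, 0],
     [0, 1, 1, 0, 0, 0, 1, 1],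
     [0, 1, 1, 0, 0, 0, 1, 1],
     [0, 0, 0, 0, 0, 0, 0, 0],
     [0, 0, 0, 0, 1, 1, 1, 1],
     [0, 0, 0, 0, 1, 1, 1, 1],
     [0, 1, 1, 0, 1, 1, 0, 0],
     [0, 1, 1, 0, 1, 1, 0, 0]]"

definition switching :: "nat \<Rightarrow> nat \<Rightarrow> nat" where
  "switching i j = rows_S ! i ! j"

section \<open>Checking the tables by evaluation\<close>

lemma latin_array_code:
  "latin_array n f \<longleftrightarrow>
     (\<forall>i\<in>set [0..<n]. distinct (map (f i) [0..<n])) \<and>
     (\<forall>j\<in>set [0..<n]. distinct (map (\<lambda>i. f i j) [0..<n])) \<and>
     (\<forall>i\<in>set [0..<n]. \<forall>j\<in>set [0..<n]. f i j < n)"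
  by (auto simp: latin_array_def distinct_map atLeast0LessThan)

text \<open>Each condition filters as soon as its variables are bound. For latin squares at most two
  values of \<open>c2\<close> and two of \<open>c1\<close> survive, so order 8 needs at most 10752
  innermost tests instead of \<open>8 ^ 6\<close>. The \<open>if\<close> lets the last agreement be
  decided before the parity is expanded.\<close>

lemma even_block_hexagon_free_code:
  assumes "set js = {..<n}"
  shows "even_block_hexagon_free n a b S \<longleftrightarrow>
    list_all (\<lambda>r1.
      list_all (\<lambda>r0.
        list_all (\<lambda>c0.
          list_all (\<lambda>c2.
            list_all (\<lambda>r2.
              list_all (\<lambda>c1.
                if agree a b r2 c2 r0 c1
                then odd (S r0 c0 + S r1 c2 + S r1 c1 + S r2 c0 + S r2 c2 + S r0 c1) else True)
              (filter (\<lambda>c1. agree a b r2 c0 r1 c1) js))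
            (filter (\<lambda>r2. r2 \<noteq> r0 \<and> r2 \<noteq> r1) js))
          (filter (\<lambda>c2. agree a b r0 c0 r1 c2) js))
        js)
      (filter (\<lambda>r0. r0 \<noteq> r1) js))
    js"
  unfolding even_block_hexagon_free_def list_all_iff set_filter assms Ball_def lessThan_iff
    mem_Collect_eq if_bool_eq_conj simp_thms
  by meson

lemma latin_array_squares: "latin_array 8 square0" "latin_array 8 square1"
  unfolding latin_array_code by code_simp+

lemma squares_orthogonal:
  "inj_on (\<lambda>(i, j). (square0 i j, square1 i j)) ({..<8} \<times> {..<8})"
proof -
  have "distinct (map (\<lambda>(i, j). (square0 i j, square1 i j)) (List.product [0..<8] [0..<8]))"
    by code_simp
  then show ?thesis by (simp only: distinct_map set_product set_upt atLeast0LessThan)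
qed

lemma switching_01: "switching_matrix 8 switching"
proof -
  have "\<forall>i\<in>set [0..<8]. \<forall>j\<in>set [0..<8]. switching i j \<in> set [0, 1]"
    by code_simp
  then show ?thesis by (simp add: switching_matrix_def)
qed

text \<open>Stated as list equations, the tables split by \<open>list.inject\<close> into 64 rewrite
  rules each, one per entry, so the search never evaluates list access.\<close>

lemma table_entries:
  "map (\<lambda>i. map (square0 i) [0, 1, 2, 3, 4, 5, 6, 7]) [0, 1, 2, 3, 4, 5, 6, 7] = rows0"
  "map (\<lambda>i. map (square1 i) [0, 1, 2, 3, 4, 5, 6, 7]) [0, 1, 2, 3, 4, 5, 6, 7] = rows1"
  "map (\<lambda>i. map (switching i) [0, 1, 2, 3, 4, 5, 6, 7]) [0, 1, 2, 3, 4, 5, 6, 7] = rows_S"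
  by (simp_all add: square0_def square1_def switching_def rows0_def rows1_def rows_S_def)

lemma list_all_weak_cong: "xs = ys \<Longrightarrow> list_all P xs = list_all P ys"
  and filter_weak_cong: "xs = ys \<Longrightarrow> filter P xs = filter P ys"
  by simp_all

text \<open>
  The weak congruence rules keep the simplifier from expanding the inner quantifiers before the
  outer variables are instantiated.
\<close>
lemma switching_even_block_hexagon_free:
  "even_block_hexagon_free 8 square0 square1 switching"
proof -
  have "set [0, 1, 2, 3, 4, 5, 6, 7] = {..<8::nat}" by auto
  note code = even_block_hexagon_free_code[OF this]
  note table = table_entries[unfolded rows0_def rows1_def rows_S_def list.map list.inject simp_thms]
  show ?thesis
    unfolding code
    by (simp only: table agree_def list.pred_inject filter.simps if_True if_False simp_thms
        numeral_eq_iff num.distinct num.inject zero_neq_numeral numeral_neq_zero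
        one_eq_numeral_iff numeral_eq_one_iff zero_neq_one one_neq_zero
        even_add dvd_0_right odd_one
        cong: list_all_weak_cong filter_weak_cong if_weak_cong)
qed

theorem mainTheorem1:
  shows "(\<exists>(R :: nat set) (C :: nat set) (L :: nat set) Q.
            latin_square R C L 16 Q \<and> K33_free Q) \<and>
         (\<exists>A0 A1 S.
            latin_square {..<8} {..<8} ((\<lambda>i. 2 * i) ` {..<8}) 8 A0 \<and>
            latin_square {..<8} {..<8} ((\<lambda>i. 2 * i + 1) ` {..<8}) 8 A1 \<and>
            orthogonal_squares A0 A1 \<and>
            switching_matrix 8 S \<and>
            latin_square {..<16} {..<16} {..<16} 16 (switched_combination 8 A0 A1 S) \<and>
            K33_free (switched_combination 8 A0 A1 S))"
proof -
  let ?A0 = "array_triples 8 (\<lambda>i j. 2 * square0 i j)"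
  let ?A1 = "array_triples 8 (\<lambda>i j. 2 * square1 i j + 1)"
  let ?Q = "switched_combination 8 ?A0 ?A1 switching"
  have Q: "?Q = array_triples (2 * 8) (switched_array square0 square1 switching)"
    by (rule switched_combination_array_triples)
  have A0: "latin_square {..<8} {..<8} ((\<lambda>i. 2 * i) ` {..<8}) 8 ?A0"
    by (rule latin_square_array_triples[OF latin_array_squares(1)]) (simp add: inj_on_def)
  have A1: "latin_square {..<8} {..<8} ((\<lambda>i. 2 * i + 1) ` {..<8}) 8 ?A1"
    by (rule latin_square_array_triples[OF latin_array_squares(2)]) (simp add: inj_on_def)
  have "inj_on (\<lambda>(i, j). (2 * square0 i j, 2 * square1 i j + 1)) ({..<8} \<times> {..<8})"
    using squares_orthogonal by (auto simp: inj_on_def)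
  then have orth: "orthogonal_squares ?A0 ?A1"
    by (rule orthogonal_squares_array_triples)
  have lat: "latin_square {..<16} {..<16} {..<16} 16 ?Q"
    unfolding Q
    using latin_square_array_triples[OF latin_array_switched_array[OF latin_array_squares], of id]
    by simp
  have free: "K33_free ?Q"
    unfolding Q
    by (rule K33_free_switched_array[OF latin_array_squares squares_orthogonal
          switching_even_block_hexagon_free])
  show ?thesis
    using A0 A1 orth switching_01 lat free by blast
qed

end
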